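(* Let $\tau$ be a unital completely positive (UCP) map on $\mathbb{M}_d$. Then the domain $\mathbb{M}_d$ has a unique vector space direct sum decomposition $$\mathbb{M}_d = \mathcal{P}(\tau) \oplus \mathcal{N}(\tau),$$ where $\mathcal{P}(\tau)$ is the peripheral space of $\tau$ and $\mathcal{N}(\tau) = \{X \in \mathbb{M}_d : \lim_{n\to\infty} \tau^n(X) = 0\}$. Furthermore, $\mathcal{P}(\tau^m) = \mathcal{P}(\tau)$ and $\mathcal{N}(\tau^m) = \mathcal{N}(\tau)$ for every $m \ge 1$.
   Context: $\mathbb{M}_d$ is the algebra of $d\times d$ complex matrices. For a UCP map $\tau$ on $\mathbb{M}_d$, the peripheral space is $\mathcal{P}(\tau) := \mathrm{span}\{X \in \mathbb{M}_d : \tau(X) = \lambda X \text{ for some } \lambda \in \mathbb{C} \text{ with } |\lambda| = 1\}$. Here $\tau^n$ denotes the $n$-fold composition of $\tau$ with itself. *)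

theory Defs
  imports "HOL-Analysis.Analysis"
begin

text \<open>The library's scalar multiplication on \<^typ>\<open>complex^'d^'d\<close> is by reals only
  (or, for \<open>*s\<close>, by row vectors), so the complex vector space structure is set up here.\<close>

definition cscale :: "complex \<Rightarrow> complex^'d^'d \<Rightarrow> complex^'d^'d" where
  "cscale c A = (\<chi> i j. c * A $ i $ j)"

global_interpretation cmat: vector_space "cscale :: complex \<Rightarrow> complex^'d^'d \<Rightarrow> complex^'d^'d"
  by unfold_locales (simp_all add: cscale_def vec_eq_iff algebra_simps)

definition cdot :: "complex^'d \<Rightarrow> complex^'d \<Rightarrow> complex" where
  "cdot v w = (\<Sum>a\<in>UNIV. cnj (v $ a) * w $ a)"

text \<open>An element of \<open>M\<^sub>k(M\<^sub>d)\<close> is a family \<open>A i j\<close> of \<open>d \<times> d\<close> matrices, read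
  only at indices \<open>i, j < k\<close>. It is positive if it is a positive semidefinite operator on the
  direct sum of \<open>k\<close> copies of \<open>\<complex>\<^sup>d\<close>.\<close>

definition block_positive :: "nat \<Rightarrow> (nat \<Rightarrow> nat \<Rightarrow> complex^'d^'d) \<Rightarrow> bool" where
  "block_positive k A \<longleftrightarrow>
     (\<forall>v :: nat \<Rightarrow> complex^'d. (\<Sum>i<k. \<Sum>j<k. cdot (v i) (A i j *v v j)) \<in> \<real>\<^sub>\<ge>\<^sub>0)"

definition completely_positive :: "(complex^'d^'d \<Rightarrow> complex^'d^'d) \<Rightarrow> bool" where
  "completely_positive \<tau> \<longleftrightarrow>
     Vector_Spaces.linear cscale cscale \<tau> \<and>
     (\<forall>k A. block_positive k A \<longrightarrow> block_positive k (\<lambda>i j. \<tau> (A i j)))"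

definition ucp :: "(complex^'d^'d \<Rightarrow> complex^'d^'d) \<Rightarrow> bool" where
  "ucp \<tau> \<longleftrightarrow> completely_positive \<tau> \<and> \<tau> (mat 1) = mat 1"

definition peripheral_space :: "(complex^'d^'d \<Rightarrow> complex^'d^'d) \<Rightarrow> (complex^'d^'d) set" where
  "peripheral_space \<tau> = cmat.span {X. \<exists>\<mu>. cmod \<mu> = 1 \<and> \<tau> X = cscale \<mu> X}"

definition decaying_space :: "(complex^'d^'d \<Rightarrow> complex^'d^'d) \<Rightarrow> (complex^'d^'d) set" where
  "decaying_space \<tau> = {X. (\<lambda>n. (\<tau> ^^ n) X) \<longlonglongrightarrow> 0}"

definition is_direct_sum :: "(complex^'d^'d) set \<Rightarrow> (complex^'d^'d) set \<Rightarrow> bool" where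
  "is_direct_sum V W \<longleftrightarrow>
     cmat.subspace V \<and> cmat.subspace W \<and> (\<forall>X. \<exists>!p\<in>V \<times> W. X = fst p + snd p)"

end

theory Submission
  imports Defs "HOL-Computational_Algebra.Fundamental_Theorem_Algebra"
begin

text \<open>Testing complete positivity on the \<open>2 \<times> 2\<close> block matrices with diagonal \<open>c I\<close> and
  off-diagonal entries \<open>X\<close> and \<open>X\<^sup>*\<close> shows that the entries of \<open>\<tau>\<^sup>n X\<close> stay bounded, so the
  theorem is one about a linear operator \<open>T\<close> with bounded orbits on a finite-dimensional space.
  Every \<open>x\<close> is annihilated by a nonzero polynomial in \<open>T\<close>, and the linear factors \<open>T - \<kappa>\<close> are
  peeled off one at a time: \<open>|\<kappa>| < 1\<close> contributes a decaying vector, \<open>|\<kappa>| > 1\<close> nothing, and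
  \<open>|\<kappa>| = 1\<close> a genuine eigenvector, since a Jordan block would make an orbit grow linearly.
  The statements on uniqueness and on powers both follow from the fact that a direct sum
  decomposition cannot be properly contained in another one.\<close>

text \<open>Applied with \<open>a n\<close> the norm of the n-th iterate, for \<kappa> inside the
  unit disc. Once the perturbation is small, only a geometrically vanishing term can keep the
  sequence above \<epsilon>/2.\<close>

lemma contraction_perturbed_tendsto_0:
  fixes a e :: "nat \<Rightarrow> real"
  assumes r: "0 \<le> r" "r < 1"
    and nonneg: "\<And>n. 0 \<le> a n"
    and step: "\<And>n. a (Suc n) \<le> r * a n + e n"
    and e: "e \<longlonglongrightarrow> 0"
  shows "a \<longlonglongrightarrow> 0"
proof (rule LIMSEQ_I)
  fix \<epsilon> :: real
  assume \<epsilon>: "0 < \<epsilon>"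
  \<comment> \<open>This threshold makes \<epsilon>/2 a fixed point of t -> r t + \<epsilon> (1 -
    r)/2, so \<open>bound\<close> survives each step of the recursion.\<close>
  have "0 < \<epsilon> * (1 - r) / 2"
    using \<epsilon> r by simp
  then obtain N where N: "\<And>n. n \<ge> N \<Longrightarrow> norm (e n - 0) < \<epsilon> * (1 - r) / 2"
    using LIMSEQ_D[OF e] by blast
  have bound: "a (N + k) \<le> r ^ k * a N + \<epsilon> / 2" for k
  proof (induction k)
    case 0
    show ?case using \<epsilon> by simp
  next
    case (Suc k)
    have "a (N + Suc k) \<le> r * a (N + k) + e (N + k)"
      using step by simp
    also have "\<dots> \<le> r * (r ^ k * a N + \<epsilon> / 2) + \<epsilon> * (1 - r) / 2"
      using N[of "N + k"] Suc.IH r by (intro add_mono mult_left_mono) auto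
    also have "\<dots> = r ^ Suc k * a N + \<epsilon> / 2"
      by (simp add: field_simps)
    finally show ?case .
  qed
  have "(\<lambda>k. r ^ k * a N) \<longlonglongrightarrow> 0"
    using tendsto_mult_left_zero[OF LIMSEQ_power_zero[of r]] r by simp
  then obtain K where K: "\<And>k. k \<ge> K \<Longrightarrow> norm (r ^ k * a N - 0) < \<epsilon> / 2"
    using LIMSEQ_D[of _ 0 "\<epsilon> / 2"] \<epsilon> by (metis half_gt_zero)
  have "norm (a n - 0) < \<epsilon>" if "n \<ge> N + K" for n
  proof -
    have "norm (r ^ (n - N) * a N - 0) < \<epsilon> / 2"
      using that by (intro K) simp
    then have "r ^ (n - N) * a N < \<epsilon> / 2"
      by simp
    then show ?thesis
      using bound[of "n - N"] nonneg[of n] that by simp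
  qed
  then show "\<exists>n0. \<forall>n\<ge>n0. norm (a n - 0) < \<epsilon>"
    by blast
qed

section \<open>Linear operators with bounded orbits\<close>

text \<open>Complex scalars supply the eigenvalues, while norm, limits and dimension come from the
  real structure of the type; \<open>scale_of_real\<close> and \<open>norm_scale\<close> tie the two
  together.\<close>

locale power_bounded_operator = vector_space scale
  for scale :: "complex \<Rightarrow> 'a::euclidean_space \<Rightarrow> 'a" (infixr \<open>*c\<close> 75) +
  fixes T :: "'a \<Rightarrow> 'a"
  assumes scale_of_real: "of_real r *c x = r *\<^sub>R x"
    and norm_scale: "norm (c *c x) = cmod c * norm x"
    and T_linear: "Vector_Spaces.linear scale scale T"
    and bounded_orbit: "bounded (range (\<lambda>n. (T ^^ n) x))"
begin

definition peripheral :: "'a set" where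
  "peripheral = span {x. \<exists>\<mu>. cmod \<mu> = 1 \<and> T x = \<mu> *c x}"

definition decaying :: "'a set" where
  "decaying = {x. (\<lambda>n. (T ^^ n) x) \<longlonglongrightarrow> 0}"

abbreviation shift :: "complex \<Rightarrow> 'a \<Rightarrow> 'a" where
  "shift \<kappa> x \<equiv> T x - \<kappa> *c x"

lemma T_add: "T (x + y) = T x + T y"
  and T_scale: "T (c *c x) = c *c T x"
  using T_linear unfolding Vector_Spaces.linear_iff by blast+

lemma T_zero [simp]: "T 0 = 0"
  using T_scale[of 0 0] by simp

lemma funpow_add_distrib: "(T ^^ n) (x + y) = (T ^^ n) x + (T ^^ n) y"
  by (induction n) (simp_all add: T_add)

lemma funpow_scale: "(T ^^ n) (c *c x) = c *c (T ^^ n) x"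
  by (induction n) (simp_all add: T_scale)

lemma funpow_diff_distrib: "(T ^^ n) (x - y) = (T ^^ n) x - (T ^^ n) y"
  using funpow_add_distrib[of n "x - y" y] by simp

lemma T_diff: "T (x - y) = T x - T y"
  using funpow_diff_distrib[of 1] by simp

lemma funpow_eigenvector: "T x = \<mu> *c x \<Longrightarrow> (T ^^ n) x = \<mu> ^ n *c x"
  by (induction n) (simp_all add: T_scale)

lemma shift_add: "shift \<kappa> (x + y) = shift \<kappa> x + shift \<kappa> y"
  by (simp add: T_add scale_right_distrib)

lemma shift_scale: "shift \<kappa> (c *c x) = c *c shift \<kappa> x"
  by (simp add: T_scale scale_right_diff_distrib mult.commute)

lemma linear_shift: "linear (shift \<kappa>)"
  by (rule linearI) (simp_all only: shift_add scale_of_real[symmetric] shift_scale)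

lemma bounded_linear_scale: "bounded_linear ((*c) c)"
  by (rule bounded_linear_intro[where K = "cmod c"])
    (simp_all add: scale_right_distrib norm_scale scale_of_real[symmetric] mult.commute)

lemma subspace_decaying: "subspace decaying"
proof (rule subspaceI)
  show "0 \<in> decaying"
    using funpow_scale[of _ 0 0] by (simp add: decaying_def)
  show "x + y \<in> decaying" if "x \<in> decaying" "y \<in> decaying" for x y
    using that tendsto_add_zero by (auto simp: decaying_def funpow_add_distrib)
  show "c *c x \<in> decaying" if "x \<in> decaying" for c x
    using that bounded_linear.tendsto_zero[OF bounded_linear_scale]
    by (auto simp: decaying_def funpow_scale)
qed

lemma subspace_peripheral: "subspace peripheral"
  by (simp add: peripheral_def)

lemma eigenvector_in_peripheral: "cmod \<mu> = 1 \<Longrightarrow> T x = \<mu> *c x \<Longrightarrow> x \<in> peripheral"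
  unfolding peripheral_def by (rule span_base) blast

section \<open>The factors T - \<kappa> and decaying vectors\<close>

lemma shift_decaying:
  assumes "x \<in> decaying"
  shows "shift \<kappa> x \<in> decaying"
proof -
  have "T x \<in> decaying"
    using assms LIMSEQ_Suc[of "\<lambda>n. (T ^^ n) x"]
    by (simp add: decaying_def funpow_swap1)
  then show ?thesis
    using assms subspace_decaying subspace_scale subspace_diff by blast
qed

lemma decaying_eigenvector_eq_0:
  assumes "x \<in> decaying" "T x = \<kappa> *c x" "1 \<le> cmod \<kappa>"
  shows "x = 0"
proof -
  have "(\<lambda>n. norm ((T ^^ n) x)) \<longlonglongrightarrow> 0"
    using assms(1) by (simp add: decaying_def tendsto_norm_zero)
  moreover have "norm x \<le> norm ((T ^^ n) x)" for n
    using assms(3) mult_right_mono[OF one_le_power[of "cmod \<kappa>" n] norm_ge_zero[of x]]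
    by (simp add: funpow_eigenvector[OF assms(2)] norm_scale norm_power)
  ultimately have "norm x \<le> 0"
    by (intro LIMSEQ_le_const[of _ 0]) auto
  then show ?thesis by simp
qed

text \<open>No nonzero decaying vector is an eigenvector for such \<kappa>, so the shift is
  injective on \<open>decaying\<close>; an injective linear map of a finite-dimensional space into
  itself is onto.\<close>

lemma image_shift_decaying:
  assumes "1 \<le> cmod \<kappa>"
  shows "shift \<kappa> ` decaying = decaying"
proof -
  have real_subspace: "real_vector.subspace decaying"
    using subspace_decaying
    by (auto simp: subspace_def real_vector.subspace_def scale_of_real[symmetric])
  have "inj_on (shift \<kappa>) decaying"
    unfolding linear_inj_on_iff_eq_0[OF linear_shift real_subspace]
    using decaying_eigenvector_eq_0 assms by auto
  then have "real_vector.dim (shift \<kappa> ` decaying) = real_vector.dim decaying"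
    using real_subspace linear_shift by (metis dim_image_eq real_vector.span_eq_iff)
  moreover have "shift \<kappa> ` decaying \<subseteq> decaying"
    using shift_decaying by blast
  ultimately show ?thesis
    by (intro subspace_dim_equal real_subspace linear_subspace_image[OF linear_shift]) simp_all
qed

text \<open>T^(n+1) x = \<kappa> T^n x + T^n (T x - \<kappa> x), so the norms of the iterates form a
  contraction perturbed by a null sequence.\<close>

lemma decaying_if_shift_decaying:
  assumes "cmod \<kappa> < 1" "shift \<kappa> x \<in> decaying"
  shows "x \<in> decaying"
proof -
  have "norm ((T ^^ Suc n) x) \<le> cmod \<kappa> * norm ((T ^^ n) x) + norm ((T ^^ n) (shift \<kappa> x))" for n
  proof -
    have "(T ^^ Suc n) x = \<kappa> *c (T ^^ n) x + (T ^^ n) (shift \<kappa> x)"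
      by (simp add: funpow_diff_distrib funpow_scale funpow_swap1)
    then show ?thesis
      using norm_triangle_ineq[of "\<kappa> *c (T ^^ n) x"] by (simp add: norm_scale)
  qed
  moreover have "(\<lambda>n. norm ((T ^^ n) (shift \<kappa> x))) \<longlonglongrightarrow> 0"
    using assms(2) by (simp add: decaying_def tendsto_norm_zero)
  ultimately have "(\<lambda>n. norm ((T ^^ n) x)) \<longlonglongrightarrow> 0"
    using assms(1) by (intro contraction_perturbed_tendsto_0[OF norm_ge_zero _ norm_ge_zero])
  then show ?thesis
    by (simp add: decaying_def tendsto_norm_zero_iff)
qed

section \<open>Eigenvectors and Jordan blocks under bounded orbits\<close>

text \<open>The extra factor \<kappa> on the left avoids the exponent n - 1 of the usual formula, so
  n = 0 needs no special treatment.\<close>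

lemma funpow_generalized_eigenvector:
  assumes "T x = \<kappa> *c x + e" "T e = \<kappa> *c e"
  shows "\<kappa> *c (T ^^ n) x = \<kappa> ^ Suc n *c x + (of_nat n * \<kappa> ^ n) *c e"
proof (induction n)
  case 0
  show ?case by simp
next
  case (Suc n)
  have "\<kappa> *c (T ^^ Suc n) x = T (\<kappa> *c (T ^^ n) x)"
    by (simp add: T_scale)
  also have "\<dots> = \<kappa> ^ Suc n *c (\<kappa> *c x + e) + (of_nat n * \<kappa> ^ n) *c \<kappa> *c e"
    by (simp only: Suc.IH T_add T_scale assms)
  also have "\<dots> = \<kappa> ^ Suc (Suc n) *c x + (of_nat (Suc n) * \<kappa> ^ Suc n) *c e"
    by (simp add: scale_right_distrib scale_left_distrib algebra_simps)
  finally show ?case .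
qed

text \<open>The e-component of the n-th iterate has norm n |e|, which a bounded orbit allows only if
  e = 0.\<close>

lemma generalized_eigenvector_trivial:
  assumes x: "T x = \<kappa> *c x + e" and e: "T e = \<kappa> *c e" and \<kappa>: "cmod \<kappa> = 1"
  shows "e = 0"
proof (rule ccontr)
  assume "e \<noteq> 0"
  obtain B where B: "\<And>n. norm ((T ^^ n) x) \<le> B"
    using bounded_orbit[of x] by (auto simp: bounded_iff)
  have "real n * norm e \<le> B + norm x" for n
  proof -
    have "(of_nat n * \<kappa> ^ n) *c e = \<kappa> *c (T ^^ n) x - \<kappa> ^ Suc n *c x"
      using funpow_generalized_eigenvector[OF x e] by simp
    then have "norm ((of_nat n * \<kappa> ^ n) *c e) \<le> norm (\<kappa> *c (T ^^ n) x) + norm (\<kappa> ^ Suc n *c x)"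
      by (metis norm_triangle_ineq4)
    then show ?thesis
      using B[of n] \<kappa> by (simp add: norm_scale norm_mult norm_power)
  qed
  moreover obtain n :: nat where "(B + norm x) / norm e < real n"
    using reals_Archimedean2 by blast
  ultimately show False
    using \<open>e \<noteq> 0\<close> by (auto simp: field_simps not_less[symmetric])
qed

lemma eigenvector_expanding_eq_0:
  assumes x: "T x = \<kappa> *c x" and \<kappa>: "1 < cmod \<kappa>"
  shows "x = 0"
proof (rule ccontr)
  assume "x \<noteq> 0"
  obtain B where B: "\<And>n. norm ((T ^^ n) x) \<le> B"
    using bounded_orbit[of x] by (auto simp: bounded_iff)
  obtain n where "B / norm x < cmod \<kappa> ^ n"
    using real_arch_pow[OF \<kappa>] by blast
  then show False
    using B[of n] \<open>x \<noteq> 0\<close>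
    by (simp add: funpow_eigenvector[OF x] norm_scale norm_power field_simps not_less[symmetric])
qed

text \<open>T is diagonalizable on a span of eigenvectors, hence that span is covered by the range
  and the kernel of T - \<kappa>: eigenvectors for \<kappa> go into e, all others into the
  range.\<close>

lemma peripheral_eq_shift_plus_eigenvector:
  assumes "u \<in> peripheral"
  shows "\<exists>v\<in>peripheral. \<exists>e. T e = \<kappa> *c e \<and> u = shift \<kappa> v + e"
  using assms unfolding peripheral_def
proof (induction rule: span_induct_alt)
  case base
  show ?case
    by (intro bexI[of _ 0] exI[of _ 0]) (auto simp: span_zero)
next
  case (step c x y)
  then obtain \<mu> where \<mu>: "cmod \<mu> = 1" "T x = \<mu> *c x"
    by blast
  from step obtain v e where v: "v \<in> peripheral" and e: "T e = \<kappa> *c e"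
    and y: "y = shift \<kappa> v + e"
    unfolding peripheral_def by blast
  have x: "x \<in> peripheral"
    using \<mu> by (rule eigenvector_in_peripheral)
  show ?case
    unfolding peripheral_def[symmetric]
  proof (cases "\<mu> = \<kappa>")
    case True
    have "T (c *c x + e) = \<kappa> *c (c *c x + e)"
      using \<mu> e True by (simp add: T_add T_scale scale_right_distrib mult.commute)
    moreover have "c *c x + y = shift \<kappa> v + (c *c x + e)"
      using y by (simp add: algebra_simps)
    ultimately show "\<exists>v\<in>peripheral. \<exists>e. T e = \<kappa> *c e \<and> c *c x + y = shift \<kappa> v + e"
      using v by blast
  next
    case False
    \<comment> \<open>T - \<kappa> multiplies x by \<mu> - \<kappa>, so dividing by this number
      gives a preimage of \<open>c *c x\<close>.\<close>
    define w where "w = (c / (\<mu> - \<kappa>)) *c x"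
    have w: "w \<in> peripheral"
      using x subspace_peripheral by (simp add: w_def subspace_scale)
    have "shift \<kappa> w = (c / (\<mu> - \<kappa>)) *c ((\<mu> - \<kappa>) *c x)"
      unfolding w_def shift_scale by (simp only: \<mu> scale_left_diff_distrib)
    also have "\<dots> = c *c x"
      using False by simp
    finally have "c *c x + y = shift \<kappa> (w + v) + e"
      unfolding shift_add using y by (simp add: add.assoc)
    then show "\<exists>v\<in>peripheral. \<exists>e. T e = \<kappa> *c e \<and> c *c x + y = shift \<kappa> v + e"
      using v w e subspace_peripheral subspace_add by blast
  qed
qed

section \<open>Polynomials in T\<close>

text \<open>This is p(T) x. The rest of the polynomial is evaluated at T x, instead of applying T to
  its value at x, so inductions on p must leave x arbitrary.\<close>

definition poly_op :: "complex poly \<Rightarrow> 'a \<Rightarrow> 'a" where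
  "poly_op p = fold_coeffs (\<lambda>a f x. a *c x + f (T x)) p (\<lambda>_. 0)"

lemma poly_op_0 [simp]: "poly_op 0 x = 0"
  by (simp add: poly_op_def)

lemma poly_op_pCons [simp]: "poly_op (pCons a p) x = a *c x + poly_op p (T x)"
  by (cases "p = 0 \<and> a = 0") (auto simp: poly_op_def)

lemma poly_op_add: "poly_op (p + q) x = poly_op p x + poly_op q x"
  by (induction p q arbitrary: x rule: poly_induct2) (simp_all add: scale_left_distrib algebra_simps)

lemma poly_op_smult: "poly_op (smult c p) x = c *c poly_op p x"
  by (induction p arbitrary: x) (simp_all add: scale_right_distrib)

lemma poly_op_add_right: "poly_op p (x + y) = poly_op p x + poly_op p y"
  by (induction p arbitrary: x y) (simp_all add: T_add scale_right_distrib algebra_simps)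

lemma poly_op_scale_right: "poly_op p (c *c x) = c *c poly_op p x"
  by (induction p arbitrary: x) (simp_all add: T_scale scale_right_distrib mult.commute)

lemma poly_op_linear_factor: "poly_op ([:- \<kappa>, 1:] * q) x = poly_op q (shift \<kappa> x)"
proof -
  have "shift \<kappa> x = T x + (- \<kappa>) *c x"
    by simp
  then show ?thesis
    by (simp only: mult_pCons_left poly_op_add poly_op_smult poly_op_pCons poly_op_0
        poly_op_add_right poly_op_scale_right) simp
qed

lemma poly_op_monom: "poly_op (monom c n) x = c *c (T ^^ n) x"
  by (induction n arbitrary: x) (simp_all add: monom_0 monom_Suc funpow_swap1)

lemma poly_op_sum: "poly_op (\<Sum>i\<in>I. p i) x = (\<Sum>i\<in>I. poly_op (p i) x)"
  by (induction I rule: infinite_finite_induct) (simp_all add: poly_op_add)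

text \<open>The dim + 1 vectors x, T x, ..., T^dim x are dependent already over the reals.
  Dependence is a property of the set of these vectors, so a repetition among them is treated
  separately, by a difference of two monomials.\<close>

lemma annihilating_polynomial: "\<exists>p. p \<noteq> 0 \<and> poly_op p x = 0"
proof -
  define f where "f = (\<lambda>i. (T ^^ i) x)"
  define I where "I = {..DIM('a)}"
  show ?thesis
  proof (cases "inj_on f I")
    case False
    then obtain i j where ij: "i \<noteq> j" "f i = f j"
      by (auto simp: inj_on_def)
    have "coeff (monom 1 i + monom (-1) j) i \<noteq> (0::complex)"
      using ij by simp
    then have "monom 1 i + monom (-1) j \<noteq> (0::complex poly)"
      by force
    moreover have "poly_op (monom 1 i + monom (-1) j) x = 0"
      using ij by (simp add: poly_op_add poly_op_monom f_def)
    ultimately show ?thesis by blast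
  next
    case True
    have "finite (f ` I)" "card (f ` I) > DIM('a)"
      using card_image[OF True] by (simp_all add: I_def)
    then have "real_vector.dependent (f ` I)"
      by (intro dependent_biggerset) auto
    then obtain u v where v: "v \<in> f ` I" "u v \<noteq> 0" and u: "(\<Sum>v\<in>f ` I. u v *\<^sub>R v) = 0"
      using real_vector.dependent_finite[OF \<open>finite (f ` I)\<close>] by blast
    obtain k where k: "k \<in> I" "u (f k) \<noteq> 0"
      using v by auto
    define p where "p = (\<Sum>i\<in>I. monom (complex_of_real (u (f i))) i)"
    have "coeff p k = of_real (u (f k))"
      using k by (simp add: p_def coeff_sum I_def)
    then have "p \<noteq> 0"
      using k by force
    moreover have "poly_op p x = (\<Sum>i\<in>I. u (f i) *\<^sub>R f i)"
      by (simp add: p_def poly_op_sum poly_op_monom scale_of_real f_def)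
    then have "poly_op p x = 0"
      using u sum.reindex[OF True, of "\<lambda>v. u v *\<^sub>R v"] by simp
    ultimately show ?thesis by blast
  qed
qed

section \<open>Existence and uniqueness of the decomposition\<close>

lemma decomposition_if_annihilated:
  assumes "p \<noteq> 0" "poly_op p x = 0"
  shows "\<exists>u\<in>peripheral. \<exists>w\<in>decaying. x = u + w"
  using assms
proof (induction "degree p" arbitrary: p x)
  case 0
  then obtain a where "p = [:a:]" "a \<noteq> 0"
    using degree_eq_zeroE[of p] by force
  then have "x = 0"
    using 0 by simp
  then show ?case
    using subspace_peripheral subspace_decaying
    by (intro bexI[of _ 0]) (auto simp: subspace_0)
next
  case (Suc n)
  have "\<not> constant (poly p)"
    using Suc.hyps(2) by (simp add: constant_degree)
  then obtain \<kappa> where "poly p \<kappa> = 0"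
    using fundamental_theorem_of_algebra by blast
  then obtain q where q: "p = [:- \<kappa>, 1:] * q"
    by (auto simp: poly_eq_0_iff_dvd)
  have "q \<noteq> 0"
    using Suc.prems q by auto
  have "degree p = 1 + degree q"
    unfolding q using \<open>q \<noteq> 0\<close> by (subst degree_mult_eq) auto
  then have "n = degree q"
    using Suc.hyps(2) by simp
  moreover have "poly_op q (shift \<kappa> x) = 0"
    using Suc.prems(2) unfolding q by (simp only: poly_op_linear_factor)
  ultimately obtain u w where u: "u \<in> peripheral" and w: "w \<in> decaying"
    and uw: "shift \<kappa> x = u + w"
    using Suc.hyps(1) \<open>q \<noteq> 0\<close> by blast
  obtain v e where v: "v \<in> peripheral" and e: "T e = \<kappa> *c e"
    and u_eq: "u = shift \<kappa> v + e"
    using peripheral_eq_shift_plus_eigenvector[OF u] by blast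
  \<comment> \<open>Subtracting v removes the peripheral part of \<open>shift \<kappa> x\<close> up
    to an eigenvector e for \<kappa>; what remains depends on the size of \<kappa>.\<close>
  have shift_xv: "shift \<kappa> (x - v) = e + w"
    unfolding linear_diff[OF linear_shift] uw u_eq by simp
  show ?case
  proof (cases "cmod \<kappa> < 1")
    case True
    \<comment> \<open>The shift sends e to 0, which decays.\<close>
    have "e \<in> decaying"
      using decaying_if_shift_decaying[OF True, of e] subspace_0[OF subspace_decaying] e by simp
    then have "e + w \<in> decaying"
      using w subspace_add[OF subspace_decaying] by blast
    then have "x - v \<in> decaying"
      using decaying_if_shift_decaying[OF True, of "x - v"] unfolding shift_xv by blast
    then show ?thesis
      using v by (intro bexI[of _ v] bexI[of _ "x - v"]) auto
  next
    case False
    then obtain z where z: "z \<in> decaying" "w = shift \<kappa> z"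
      using image_shift_decaying[of \<kappa>] w by (auto simp: not_less)
    \<comment> \<open>Subtracting z cancels w as well, so that y and e form a Jordan chain for
      \<kappa>.\<close>
    define y where "y = x - v - z"
    have "shift \<kappa> y = shift \<kappa> (x - v) - w"
      unfolding y_def z(2) by (rule linear_diff[OF linear_shift])
    also have "\<dots> = e"
      unfolding shift_xv by simp
    finally have "shift \<kappa> y = e" .
    then have y: "T y = \<kappa> *c y + e"
      by (simp add: algebra_simps)
    have "y \<in> peripheral"
    proof (cases "cmod \<kappa> = 1")
      case True
      then show ?thesis
        using generalized_eigenvector_trivial[OF y e] y eigenvector_in_peripheral[of \<kappa> y] by simp
    next
      case neq_1: False
      then have "1 < cmod \<kappa>"
        using False by simp
      moreover from this have "e = 0"
        using eigenvector_expanding_eq_0[OF e] by blast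
      ultimately have "y = 0"
        using eigenvector_expanding_eq_0[of y \<kappa>] y by simp
      then show ?thesis
        using subspace_0[OF subspace_peripheral] by simp
    qed
    then have "v + y \<in> peripheral"
      using v subspace_add[OF subspace_peripheral] by blast
    then show ?thesis
      using z by (intro bexI[of _ "v + y"] bexI[of _ z]) (auto simp: y_def)
  qed
qed

lemma fold_shift_add: "fold shift ls (x + y) = fold shift ls x + fold shift ls y"
  by (induction ls arbitrary: x y) (simp_all only: fold_simps shift_add)

lemma fold_shift_scale: "fold shift ls (c *c x) = c *c fold shift ls x"
  by (induction ls arbitrary: x) (simp_all only: fold_simps shift_scale)

lemma fold_shift_shift: "fold shift ls (shift \<mu> x) = shift \<mu> (fold shift ls x)"
proof (induction ls arbitrary: x)
  case (Cons \<kappa> ls)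
  have "shift \<kappa> (shift \<mu> x) = shift \<mu> (shift \<kappa> x)"
    by (simp add: T_diff T_scale scale_right_diff_distrib algebra_simps)
  then show ?case
    using Cons.IH by simp
qed simp

text \<open>A combination of eigenvectors is killed by the product of the factors T - \<mu> over
  their eigenvalues, because the factors commute. A list keeps the factors separate, so that they
  can be cancelled one by one.\<close>

lemma peripheral_annihilated:
  assumes "x \<in> peripheral"
  shows "\<exists>ls. (\<forall>\<kappa>\<in>set ls. cmod \<kappa> = 1) \<and> fold shift ls x = 0"
  using assms unfolding peripheral_def
proof (induction rule: span_induct_alt)
  case base
  show ?case by (intro exI[of _ "[]"]) simp
next
  case (step c x y)
  then obtain \<mu> ls where \<mu>: "cmod \<mu> = 1" "T x = \<mu> *c x"
    and ls: "\<forall>\<kappa>\<in>set ls. cmod \<kappa> = 1" "fold shift ls y = 0"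
    by blast
  have "shift \<mu> (c *c x + y) = shift \<mu> y"
    unfolding shift_add shift_scale by (simp add: \<mu>)
  then have "fold shift (\<mu> # ls) (c *c x + y) = 0"
    using ls fold_shift_shift[where ls = ls and x = y] by simp
  then show ?case
    using \<mu> ls by (intro exI[of _ "\<mu> # ls"]) simp
qed

text \<open>Each factor maps \<open>decaying\<close> injectively into itself, hence so does their
  product.\<close>

lemma decaying_annihilated_eq_0:
  assumes "x \<in> decaying" "\<forall>\<kappa>\<in>set ls. 1 \<le> cmod \<kappa>" "fold shift ls x = 0"
  shows "x = 0"
  using assms
proof (induction ls arbitrary: x)
  case (Cons \<kappa> ls)
  then have "shift \<kappa> x = 0"
    using Cons.IH[OF shift_decaying] by simp
  then show ?case
    using Cons.prems decaying_eigenvector_eq_0[of x \<kappa>] by simp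
qed simp

lemma peripheral_Int_decaying:
  assumes "x \<in> peripheral" "x \<in> decaying"
  shows "x = 0"
proof -
  obtain ls where "\<forall>\<kappa>\<in>set ls. cmod \<kappa> = 1" "fold shift ls x = 0"
    using peripheral_annihilated[OF assms(1)] by blast
  then show ?thesis
    using decaying_annihilated_eq_0[OF assms(2), of ls] by simp
qed

theorem peripheral_decaying_decomposition: "\<exists>!p\<in>peripheral \<times> decaying. x = fst p + snd p"
proof -
  obtain p where "p \<noteq> 0" "poly_op p x = 0"
    using annihilating_polynomial by blast
  then obtain u w where uw: "u \<in> peripheral" "w \<in> decaying" "x = u + w"
    using decomposition_if_annihilated by blast
  have unique: "q = (u, w)" if "q \<in> peripheral \<times> decaying" "x = fst q + snd q" for q
  proof -
    have eq: "fst q - u = w - snd q"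
      using uw(3) that(2) by (simp add: algebra_simps)
    have "fst q - u \<in> peripheral"
      using uw(1) that(1) by (intro subspace_diff subspace_peripheral) auto
    moreover have "fst q - u \<in> decaying"
      unfolding eq using uw(2) that(1) by (intro subspace_diff subspace_decaying) auto
    ultimately have "fst q - u = 0"
      by (rule peripheral_Int_decaying)
    then show ?thesis
      using eq by (simp add: prod_eq_iff)
  qed
  show ?thesis
  proof (rule ex1I[of _ "(u, w)"])
    show "(u, w) \<in> peripheral \<times> decaying \<and> x = fst (u, w) + snd (u, w)"
      using uw by simp
  qed (use unique in blast)
qed

end

section \<open>Bounded orbits of UCP maps\<close>

lemma norm_cscale: "norm (cscale c A) = cmod c * norm A"
  by (simp add: norm_vec_def cscale_def norm_mult L2_set_right_distrib)

lemma cscale_of_real: "cscale (of_real r) A = r *\<^sub>R A"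
  by (simp add: cscale_def vec_eq_iff) (simp add: scaleR_conv_of_real)

lemma mat_conv_cscale: "mat c = cscale c (mat 1)"
  by (simp add: cscale_def mat_def vec_eq_iff)

text \<open>Y is left arbitrary, so nothing has to be shown about \<tau> and adjoints when \<tau> is
  applied to the blocks.\<close>

lemma block_positive_2_iff:
  "block_positive 2 (\<lambda>i j. if i = j then mat c else if i = 0 then X else Y) \<longleftrightarrow>
    (\<forall>v w. cdot v (mat c *v v) + cdot v (X *v w) + (cdot w (Y *v v) + cdot w (mat c *v w))
      \<in> \<real>\<^sub>\<ge>\<^sub>0)" (is "?L \<longleftrightarrow> ?R")
proof
  assume L: ?L
  show ?R
  proof (intro allI)
    fix v w :: "complex^'a"
    show "cdot v (mat c *v v) + cdot v (X *v w) + (cdot w (Y *v v) + cdot w (mat c *v w)) \<in> \<real>\<^sub>\<ge>\<^sub>0"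
      using L[unfolded block_positive_def, rule_format, of "\<lambda>i. if i = 0 then v else w"]
      by (simp add: numeral_2_eq_2)
  qed
next
  assume ?R
  then show ?L
    by (simp add: block_positive_def numeral_2_eq_2)
qed

lemma cdot_matrix_mult: "cdot v (A *v w) = (\<Sum>a\<in>UNIV. \<Sum>b\<in>UNIV. cnj (v $ a) * A $ a $ b * w $ b)"
  by (simp add: cdot_def matrix_vector_mult_def sum_distrib_left mult.assoc)

lemma cdot_mat: "cdot v (mat c *v v) = c * of_real (\<Sum>a\<in>UNIV. (cmod (v $ a))\<^sup>2)"
proof -
  have "mat c *v v = c *s v"
    by (simp add: vec_eq_iff matrix_vector_mult_def mat_def if_distrib[of "\<lambda>x. x * _"] cong: if_cong)
  then show ?thesis
    by (simp add: cdot_def sum_distrib_left complex_norm_square mult.left_commute mult.commute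
        del: of_real_power)
qed

text \<open>With Y the adjoint of X, the off-diagonal terms add up to 2 Re z for z =
  \<open>cdot v (X *v w)\<close>. Bounding each product |v_a| |w_b| by half of |v|^2 + |w|^2 shows
  that the sum of the |X_ab| is large enough as c.\<close>

lemma exists_block_positive_2:
  fixes X :: "complex^'d^'d"
  obtains c Y where
    "block_positive 2 (\<lambda>i j. if i = j then mat (complex_of_real c) else if i = 0 then X else Y)"
proof
  define c where "c = (\<Sum>a\<in>UNIV. \<Sum>b\<in>UNIV. cmod (X $ a $ b))"
  define Y where "Y = (\<chi> i j. cnj (X $ j $ i))"
  let ?S = "\<lambda>v :: complex^'d. \<Sum>a\<in>UNIV. (cmod (v $ a))\<^sup>2"
  have "cdot v (mat c *v v) + cdot v (X *v w) + (cdot w (Y *v v) + cdot w (mat c *v w)) \<in> \<real>\<^sub>\<ge>\<^sub>0"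
    for v w
  proof -
    define z where "z = cdot v (X *v w)"
    have S: "(cmod (v $ a))\<^sup>2 \<le> ?S v" for v and a :: 'd
      by (rule member_le_sum) auto
    have "cmod z \<le> (\<Sum>a\<in>UNIV. \<Sum>b\<in>UNIV. cmod (cnj (v $ a) * X $ a $ b * w $ b))"
      unfolding z_def cdot_matrix_mult by (intro order_trans[OF norm_sum] sum_mono norm_sum)
    also have "\<dots> \<le> (\<Sum>a\<in>UNIV. \<Sum>b\<in>UNIV. cmod (X $ a $ b) * ((?S v + ?S w) / 2))"
    proof (intro sum_mono)
      fix a b :: 'd
      have "2 * (cmod (v $ a) * cmod (w $ b)) \<le> (cmod (v $ a))\<^sup>2 + (cmod (w $ b))\<^sup>2"
        using sum_squares_bound[of "cmod (v $ a)" "cmod (w $ b)"] by simp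
      also have "\<dots> \<le> ?S v + ?S w"
        by (intro add_mono S)
      finally have "cmod (v $ a) * cmod (w $ b) \<le> (?S v + ?S w) / 2"
        by simp
      then have "cmod (X $ a $ b) * (cmod (v $ a) * cmod (w $ b)) \<le> cmod (X $ a $ b) * ((?S v + ?S w) / 2)"
        by (rule mult_left_mono) simp
      then show "cmod (cnj (v $ a) * X $ a $ b * w $ b) \<le> cmod (X $ a $ b) * ((?S v + ?S w) / 2)"
        by (simp add: norm_mult mult_ac)
    qed
    also have "\<dots> = c * ((?S v + ?S w) / 2)"
      by (simp only: c_def sum_distrib_right)
    finally have "0 \<le> c * (?S v + ?S w) + 2 * Re z"
      using abs_Re_le_cmod[of z] by linarith
    moreover have "cdot w (Y *v v) = cnj z"
      unfolding z_def cdot_matrix_mult Y_def by (subst sum.swap) (simp add: mult_ac)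
    then have "cdot v (mat c *v v) + cdot v (X *v w) + (cdot w (Y *v v) + cdot w (mat c *v w))
        = of_real (c * (?S v + ?S w) + 2 * Re z)"
      using complex_add_cnj[of z] by (simp add: cdot_mat z_def algebra_simps)
    ultimately show ?thesis
      by (metis nonneg_Reals_of_real_iff)
  qed
  then show "block_positive 2 (\<lambda>i j. if i = j then mat (complex_of_real c) else if i = 0 then X else Y)"
    unfolding block_positive_2_iff by blast
qed

text \<open>Testing with multiples of the basis vectors e_a and e_b isolates the entries X_ab and
  Y_ba; the phase u then probes X_ab in different directions.\<close>

lemma block_positive_2_entry_bound:
  assumes "block_positive 2 (\<lambda>i j. if i = j then mat (complex_of_real c) else if i = 0 then X else Y)"
  shows "cmod (X $ a $ b) \<le> 2 * c"
proof -
  have pos: "of_real c + of_real c + (u * X $ a $ b + cnj u * Y $ b $ a) \<in> \<real>\<^sub>\<ge>\<^sub>0" if "cmod u = 1" for u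
  proof -
    have entry: "cdot (axis i s) (A *v axis j t) = cnj s * A $ i $ j * t" for A :: "complex^'a^'a" and i j s t
      by (simp add: cdot_def matrix_vector_mult_def axis_def if_distrib[of cnj]
          if_distrib[of "\<lambda>x. x * _"] if_distrib[of "\<lambda>x. _ * x"] cong: if_cong)
    have "u * cnj u = 1"
      using that complex_norm_square[of u] by simp
    then have "u * of_real c * cnj u = of_real c"
      by (simp add: mult.commute mult.left_commute)
    then have "cnj (cnj u) * mat (of_real c) $ a $ a * cnj u + cnj (cnj u) * X $ a $ b * 1
        + (cnj 1 * Y $ b $ a * cnj u + cnj 1 * mat (of_real c) $ b $ b * 1)
      = of_real c + of_real c + (u * X $ a $ b + cnj u * Y $ b $ a)"
      by (simp only: mat_def) simp
    then show ?thesis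
      using assms[unfolded block_positive_2_iff, rule_format, of "axis a (cnj u)" "axis b 1"]
      by (simp only: entry)
  qed
  \<comment> \<open>That the four values are real forces Y_ba to be the conjugate of X_ab; that they
    are nonnegative then bounds twice the real and imaginary parts by 2c.\<close>
  have "\<bar>Re (X $ a $ b)\<bar> \<le> c" "\<bar>Im (X $ a $ b)\<bar> \<le> c"
    using pos[of 1] pos[of "-1"] pos[of \<i>] pos[of "-\<i>"]
    by (auto simp: complex_nonneg_Reals_iff)
  then show ?thesis
    using cmod_le[of "X $ a $ b"] by linarith
qed

text \<open>Unitality fixes the diagonal blocks, so one constant c serves all iterates and the entry
  bound is uniform in n.\<close>

lemma ucp_funpow_block_positive_2:
  assumes \<tau>: "ucp \<tau>"
    and X: "block_positive 2 (\<lambda>i j. if i = j then mat c else if i = 0 then X else Y)"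
  shows "block_positive 2 (\<lambda>i j. if i = j then mat c else if i = 0 then (\<tau> ^^ n) X else (\<tau> ^^ n) Y)"
proof (induction n)
  case 0
  show ?case using X by (simp only: funpow_0)
next
  case (Suc n)
  let ?A = "\<lambda>i j :: nat. if i = j then mat c else if i = 0 then (\<tau> ^^ n) X else (\<tau> ^^ n) Y"
  have "\<tau> (mat c) = mat c"
    using \<tau> unfolding mat_conv_cscale[of c]
    by (simp add: ucp_def completely_positive_def Vector_Spaces.linear_iff)
  then have "(\<lambda>i j. \<tau> (?A i j)) =
      (\<lambda>i j. if i = j then mat c else if i = 0 then (\<tau> ^^ Suc n) X else (\<tau> ^^ Suc n) Y)"
    by (simp add: fun_eq_iff)
  moreover have "block_positive 2 (\<lambda>i j. \<tau> (?A i j))"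
    using \<tau> Suc.IH by (simp add: ucp_def completely_positive_def)
  ultimately show ?case
    by (simp only:)
qed

lemma ucp_bounded_orbit:
  fixes \<tau> :: "complex^'d^'d \<Rightarrow> complex^'d^'d"
  assumes "ucp \<tau>"
  shows "bounded (range (\<lambda>n. (\<tau> ^^ n) X))"
proof -
  obtain c Y where
    "block_positive 2 (\<lambda>i j. if i = j then mat (complex_of_real c) else if i = 0 then X else Y)"
    by (rule exists_block_positive_2)
  from block_positive_2_entry_bound[OF ucp_funpow_block_positive_2[OF assms this]]
  have entry: "cmod ((\<tau> ^^ n) X $ a $ b) \<le> 2 * c" for n a b .
  have norm_le_sum: "norm v \<le> (\<Sum>i\<in>UNIV. norm (v $ i))" for v :: "'b::real_normed_vector^'d"
    by (simp add: norm_vec_def L2_set_le_sum)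
  have "norm ((\<tau> ^^ n) X) \<le> (\<Sum>a\<in>(UNIV::'d set). \<Sum>b\<in>(UNIV::'d set). 2 * c)" for n
    by (intro order_trans[OF norm_le_sum] sum_mono entry)
  then show ?thesis
    unfolding bounded_iff by blast
qed

section \<open>Comparing direct sums, and passing to powers\<close>

text \<open>If x in P splits as v + w along V and W, then this and x + 0 are both splittings along P
  and N, so x = v lies in V; likewise for N.\<close>

lemma is_direct_sum_subset_eq:
  assumes VW: "is_direct_sum V W" and PN: "is_direct_sum P N"
    and sub: "V \<subseteq> P" "W \<subseteq> N"
  shows "V = P \<and> W = N"
proof -
  have unique: "p = q" if "p \<in> P \<times> N" "q \<in> P \<times> N" "fst p + snd p = fst q + snd q" for p q
    using PN that unfolding is_direct_sum_def by metis
  have split: "\<exists>v\<in>V. \<exists>w\<in>W. x = v + w" for x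
    using VW unfolding is_direct_sum_def by (metis mem_Times_iff)
  have zero: "0 \<in> P" "0 \<in> N"
    using PN cmat.subspace_0 unfolding is_direct_sum_def by auto
  have "x \<in> V" if "x \<in> P" for x
    using split[of x] unique[of "(x, 0)"] zero sub that by fastforce
  moreover have "x \<in> W" if "x \<in> N" for x
    using split[of x] unique[of "(0, x)"] zero sub that by fastforce
  ultimately show ?thesis
    using sub by blast
qed

text \<open>Assuming only linearity and bounded orbits lets this apply to the powers of a UCP map
  without showing that they are UCP.\<close>

lemma peripheral_decaying_direct_sum:
  fixes \<tau> :: "complex^'d^'d \<Rightarrow> complex^'d^'d"
  assumes "Vector_Spaces.linear cscale cscale \<tau>"
    and "\<And>X. bounded (range (\<lambda>n. (\<tau> ^^ n) X))"
  shows "is_direct_sum (peripheral_space \<tau>) (decaying_space \<tau>)"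
proof -
  interpret power_bounded_operator cscale \<tau>
    using assms
    by (intro power_bounded_operator.intro power_bounded_operator_axioms.intro cmat.vector_space_axioms)
      (simp_all add: norm_cscale cscale_of_real)
  have "peripheral_space \<tau> = peripheral" "decaying_space \<tau> = decaying"
    by (simp_all add: peripheral_space_def peripheral_def decaying_space_def decaying_def)
  then show ?thesis
    using subspace_peripheral subspace_decaying peripheral_decaying_decomposition
    by (simp add: is_direct_sum_def)
qed

theorem theorem3p1:
  fixes \<tau> :: "complex^'d^'d \<Rightarrow> complex^'d^'d"
  assumes "ucp \<tau>"
  shows "is_direct_sum (peripheral_space \<tau>) (decaying_space \<tau>)
    \<and> (\<forall>V W. is_direct_sum V W \<and> V \<subseteq> peripheral_space \<tau> \<and> W \<subseteq> decaying_space \<tau>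
          \<longrightarrow> V = peripheral_space \<tau> \<and> W = decaying_space \<tau>)
    \<and> (\<forall>m\<ge>1. peripheral_space (\<tau> ^^ m) = peripheral_space \<tau>
          \<and> decaying_space (\<tau> ^^ m) = decaying_space \<tau>)"
proof -
  have lin: "Vector_Spaces.linear cscale cscale \<tau>"
    using assms by (simp add: ucp_def completely_positive_def)
  have scale: "(\<tau> ^^ m) (cscale c X) = cscale c ((\<tau> ^^ m) X)"
    and add: "(\<tau> ^^ m) (X + Y) = (\<tau> ^^ m) X + (\<tau> ^^ m) Y" for m c X Y
    using lin by (induction m) (simp_all add: Vector_Spaces.linear_iff)
  have direct_sum: "is_direct_sum (peripheral_space (\<tau> ^^ m)) (decaying_space (\<tau> ^^ m))" for m
  proof (rule peripheral_decaying_direct_sum)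
    show "Vector_Spaces.linear cscale cscale (\<tau> ^^ m)"
      using scale add by (simp add: Vector_Spaces.linear_iff cmat.vector_space_axioms)
    show "bounded (range (\<lambda>n. ((\<tau> ^^ m) ^^ n) X))" for X
      \<comment> \<open>The orbit of X under \<tau>^m is part of its orbit under \<tau>.\<close>
      by (rule bounded_subset[OF ucp_bounded_orbit[OF assms, of X]]) (auto simp: funpow_mult)
  qed
  have "peripheral_space \<tau> \<subseteq> peripheral_space (\<tau> ^^ m)" for m
    unfolding peripheral_space_def
  proof (rule cmat.span_mono, safe)
    fix X \<mu>
    assume \<mu>: "cmod \<mu> = 1" "\<tau> X = cscale \<mu> X"
    have "(\<tau> ^^ m) X = cscale (\<mu> ^ m) X"
      using \<mu> scale[of 1] by (induction m) (simp_all add: mult.commute)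
    then show "\<exists>\<nu>. cmod \<nu> = 1 \<and> (\<tau> ^^ m) X = cscale \<nu> X"
      using \<mu> by (intro exI[of _ "\<mu> ^ m"]) (simp add: norm_power)
  qed
  moreover have "decaying_space \<tau> \<subseteq> decaying_space (\<tau> ^^ m)" if "m \<ge> 1" for m
  proof
    fix X
    assume "X \<in> decaying_space \<tau>"
    moreover have "strict_mono (\<lambda>n. m * n)"
      using that by (simp add: strict_mono_def)
    ultimately show "X \<in> decaying_space (\<tau> ^^ m)"
      using LIMSEQ_subseq_LIMSEQ[of "\<lambda>n. (\<tau> ^^ n) X" 0 "\<lambda>n. m * n"]
      by (simp add: decaying_space_def funpow_mult o_def)
  qed
  \<comment> \<open>Only the easy inclusions were shown; the reverse ones follow because both pairs
    are direct sum decompositions.\<close>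
  ultimately have "peripheral_space \<tau> = peripheral_space (\<tau> ^^ m)
      \<and> decaying_space \<tau> = decaying_space (\<tau> ^^ m)" if "m \<ge> 1" for m
    using is_direct_sum_subset_eq[OF direct_sum[of 1] direct_sum[of m]] that by simp
  moreover have "is_direct_sum (peripheral_space \<tau>) (decaying_space \<tau>)"
    using direct_sum[of 1] by simp
  ultimately show ?thesis
    using is_direct_sum_subset_eq by metis
qed

end
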